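(* Let $\Pi$ be a minimization selection problem, and let $A$ be a $\rho$-approximation algorithm for $\Pi$ running in time $T(n)$. Then there exists an $O(T(n))$-time learning-augmented approximation algorithm for $\Pi$ with the following guarantee: upon receiving an instance of $\Pi$ together with a (not necessarily feasible) predicted solution $\widehat{X} \subseteq [n]$, it outputs a feasible solution $X \in \mathcal{X}$ such that, for any feasible solution $X' \in \mathcal{X}$, \[ w(X) \leqslant w(X') + \eta^+ + (\rho-1)\cdot \eta^-, \] where $(\eta^+,\eta^-)$ is the error of $\widehat{X}$ with respect to $X'$.
   Context: A minimization selection problem: an instance consists of $n$ items $[n]=\{1,\dots,n\}$ with non-negative weights $w:[n]\to\mathbb{R}_{\geqslant 0}$ and an implicitly given collection $\mathcal{X}\subseteq 2^{[n]}$ of feasible sets (the collection does not depend on the weights; any non-negative weight function gives a valid instance); the task is to find $X\in\mathcal{X}$ minimizing $w(X)=\sum_{i\in X}w(i)$. A $\rho$-approximation algorithm ($\rho\geqslant 1$) always outputs a feasible $X$ with $w(X)\leqslant \rho\cdot w(X^* )$ where $X^*$ is an optimal solution. A learning-augmented algorithm additionally receives a prediction $\widehat{X}\subseteq[n]$. The error of $\widehat{X}$ with respect to a solution $X$ is the pair $(\eta^+,\eta^-)$ with $\eta^+ = w(\widehat{X}\setminus X)$ and $\eta^- = w(X\setminus \widehat{X})$. *)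

theory Defs
  imports Complex_Main "HOL-Library.Landau_Symbols"
begin

text \<open>
  Unit-cost real RAM. Integers and reals are kept apart (there is no rounding from reals to
  integers). Registers are addressed directly, so a program uses only finitely many of them; the
  memories, addressed by integers, are accessed through the content of an integer register.
  The input consists of a random-access read-only integer array and real array.
\<close>

datatype arith = Add | Sub | Mul | Div

datatype instr =
    IConst nat int
  | IArith arith nat nat nat
  | ILoad nat nat
  | IStore nat nat
  | IRead nat nat
  | ILen nat
  | RofI nat nat
  | RArith arith nat nat nat
  | RLoad nat nat
  | RStore nat nat
  | RRead nat nat
  | RLen nat
  | Emit nat
  | Jump nat
  | IJumpLess nat nat nat
  | RJumpLess nat nat nat

type_synonym ram_program = "instr list"
type_synonym ram_input = "int list \<times> real list"

record config =
  pc :: nat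
  ireg :: "nat \<Rightarrow> int"
  rreg :: "nat \<Rightarrow> real"
  imem :: "int \<Rightarrow> int"
  rmem :: "int \<Rightarrow> real"
  out :: "int list"

fun int_arith :: "arith \<Rightarrow> int \<Rightarrow> int \<Rightarrow> int" where
  "int_arith Add a b = a + b"
| "int_arith Sub a b = a - b"
| "int_arith Mul a b = a * b"
| "int_arith Div a b = a div b"

fun real_arith :: "arith \<Rightarrow> real \<Rightarrow> real \<Rightarrow> real" where
  "real_arith Add a b = a + b"
| "real_arith Sub a b = a - b"
| "real_arith Mul a b = a * b"
| "real_arith Div a b = a / b"

definition lookup :: "'a::zero list \<Rightarrow> int \<Rightarrow> 'a" where
  "lookup xs k = (if 0 \<le> k \<and> k < int (length xs) then xs ! nat k else 0)"

abbreviation set_ireg :: "nat \<Rightarrow> int \<Rightarrow> config \<Rightarrow> config" where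
  "set_ireg x v c \<equiv> c\<lparr>ireg := (ireg c)(x := v), pc := Suc (pc c)\<rparr>"

abbreviation set_rreg :: "nat \<Rightarrow> real \<Rightarrow> config \<Rightarrow> config" where
  "set_rreg x v c \<equiv> c\<lparr>rreg := (rreg c)(x := v), pc := Suc (pc c)\<rparr>"

fun exec :: "ram_input \<Rightarrow> instr \<Rightarrow> config \<Rightarrow> config" where
  "exec I (IConst x k) c = set_ireg x k c"
| "exec I (IArith f x y z) c = set_ireg x (int_arith f (ireg c y) (ireg c z)) c"
| "exec I (ILoad x y) c = set_ireg x (imem c (ireg c y)) c"
| "exec I (IStore x y) c = c\<lparr>imem := (imem c)(ireg c x := ireg c y), pc := Suc (pc c)\<rparr>"
| "exec I (IRead x y) c = set_ireg x (lookup (fst I) (ireg c y)) c"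
| "exec I (ILen x) c = set_ireg x (int (length (fst I))) c"
| "exec I (RofI x y) c = set_rreg x (real_of_int (ireg c y)) c"
| "exec I (RArith f x y z) c = set_rreg x (real_arith f (rreg c y) (rreg c z)) c"
| "exec I (RLoad x y) c = set_rreg x (rmem c (ireg c y)) c"
| "exec I (RStore x y) c = c\<lparr>rmem := (rmem c)(ireg c x := rreg c y), pc := Suc (pc c)\<rparr>"
| "exec I (RRead x y) c = set_rreg x (lookup (snd I) (ireg c y)) c"
| "exec I (RLen x) c = set_ireg x (int (length (snd I))) c"
| "exec I (Emit x) c = c\<lparr>out := out c @ [ireg c x], pc := Suc (pc c)\<rparr>"
| "exec I (Jump l) c = c\<lparr>pc := l\<rparr>"
| "exec I (IJumpLess x y l) c = c\<lparr>pc := (if ireg c x < ireg c y then l else Suc (pc c))\<rparr>"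
| "exec I (RJumpLess x y l) c = c\<lparr>pc := (if rreg c x < rreg c y then l else Suc (pc c))\<rparr>"

definition halted :: "ram_program \<Rightarrow> config \<Rightarrow> bool" where
  "halted p c \<longleftrightarrow> length p \<le> pc c"

definition step :: "ram_program \<Rightarrow> ram_input \<Rightarrow> config \<Rightarrow> config" where
  "step p I c = (if halted p c then c else exec I (p ! pc c) c)"

definition init_config :: config where
  "init_config = \<lparr>pc = 0, ireg = (\<lambda>_. 0), rreg = (\<lambda>_. 0), imem = (\<lambda>_. 0), rmem = (\<lambda>_. 0), out = []\<rparr>"

definition config_after :: "ram_program \<Rightarrow> ram_input \<Rightarrow> nat \<Rightarrow> config" where
  "config_after p I t = (step p I ^^ t) init_config"

definition halts_within :: "ram_program \<Rightarrow> ram_input \<Rightarrow> real \<Rightarrow> bool" where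
  "halts_within p I b \<longleftrightarrow> (\<exists>t. real t \<le> b \<and> halted p (config_after p I t))"

definition outputs_set :: "ram_program \<Rightarrow> ram_input \<Rightarrow> nat set \<Rightarrow> bool" where
  "outputs_set p I X \<longleftrightarrow>
     (\<exists>t. halted p (config_after p I t) \<and> set (out (config_after p I t)) = int ` X)"

text \<open>
  An instance without its weights: the number of items and the finite data (integers and reals,
  for example an encoded graph) by which the collection of feasible sets is implicitly given.
\<close>

record family_data =
  num_items :: nat
  int_data :: "int list"
  real_data :: "real list"

record selection_problem =
  families :: "family_data set"
  feasible :: "family_data \<Rightarrow> nat set set"

abbreviation items :: "family_data \<Rightarrow> nat set" where
  "items d \<equiv> {1..num_items d}"

definition wf_selection_problem :: "selection_problem \<Rightarrow> bool" where
  "wf_selection_problem P \<longleftrightarrow> (\<forall>d\<in>families P. feasible P d \<subseteq> Pow (items d))"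

definition valid_weights :: "family_data \<Rightarrow> (nat \<Rightarrow> real) \<Rightarrow> bool" where
  "valid_weights d w \<longleftrightarrow> (\<forall>i\<in>items d. 0 \<le> w i)"

definition optimal_solution ::
  "selection_problem \<Rightarrow> family_data \<Rightarrow> (nat \<Rightarrow> real) \<Rightarrow> nat set \<Rightarrow> bool" where
  "optimal_solution P d w X \<longleftrightarrow>
     X \<in> feasible P d \<and> (\<forall>Y\<in>feasible P d. sum w X \<le> sum w Y)"

definition prediction_error :: "(nat \<Rightarrow> real) \<Rightarrow> nat set \<Rightarrow> nat set \<Rightarrow> real \<times> real" where
  "prediction_error w Xh X = (sum w (Xh - X), sum w (X - Xh))"

definition plain_input :: "family_data \<Rightarrow> (nat \<Rightarrow> real) \<Rightarrow> ram_input" where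
  "plain_input d w =
     (int (num_items d) # int_data d, map w [1..<Suc (num_items d)] @ real_data d)"

text \<open>The prediction is supplied as its 0/1 characteristic vector.\<close>

definition augmented_input :: "family_data \<Rightarrow> (nat \<Rightarrow> real) \<Rightarrow> nat set \<Rightarrow> ram_input" where
  "augmented_input d w Xh =
     (int (num_items d) # map (\<lambda>i. if i \<in> Xh then 1 else 0) [1..<Suc (num_items d)] @ int_data d,
      map w [1..<Suc (num_items d)] @ real_data d)"

definition approximation_algorithm :: "selection_problem \<Rightarrow> real \<Rightarrow> ram_program \<Rightarrow> bool" where
  "approximation_algorithm P \<rho> A \<longleftrightarrow>
     (\<forall>d\<in>families P. \<forall>w. valid_weights d w \<longrightarrow>
        (\<exists>X\<in>feasible P d. outputs_set A (plain_input d w) X \<and>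
           (\<forall>Xopt. optimal_solution P d w Xopt \<longrightarrow> sum w X \<le> \<rho> * sum w Xopt)))"

definition runs_in_time :: "selection_problem \<Rightarrow> ram_program \<Rightarrow> (nat \<Rightarrow> real) \<Rightarrow> bool" where
  "runs_in_time P A T \<longleftrightarrow>
     (\<forall>d\<in>families P. \<forall>w. valid_weights d w \<longrightarrow>
        halts_within A (plain_input d w) (T (num_items d)))"

definition augmented_runs_in_time ::
  "selection_problem \<Rightarrow> ram_program \<Rightarrow> (nat \<Rightarrow> real) \<Rightarrow> bool" where
  "augmented_runs_in_time P B T \<longleftrightarrow>
     (\<forall>d\<in>families P. \<forall>w Xh. valid_weights d w \<longrightarrow> Xh \<subseteq> items d \<longrightarrow>
        halts_within B (augmented_input d w Xh) (T (num_items d)))"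

end

theory Submission
  imports Defs
begin

text \<open>
  Set the weight of every predicted item to 0 and run the given algorithm. If \<open>w'\<close> denotes the new
  weights, its output \<open>X\<close> satisfies, for every feasible \<open>X'\<close>,
  \<open>w(X) \<le> w'(X) + w(Xh) \<le> \<rho> w(X' - Xh) + w(Xh \<inter> X') + w(Xh - X') = w(X') + \<eta>p + (\<rho> - 1) \<eta>m\<close>.
  Since \<open>T\<close> may be sublinear, the new weights must not be written down in advance: the modified
  machine instead replaces every instruction by a block of 12 instructions, and the blocks for
  reading the input consult the prediction on the fly.
\<close>

section \<open>Zeroing the weights of the predicted items\<close>

abbreviation zeroed_weights :: "nat set \<Rightarrow> (nat \<Rightarrow> real) \<Rightarrow> nat \<Rightarrow> real" where
  "zeroed_weights Xh w \<equiv> (\<lambda>i. if i \<in> Xh then 0 else w i)"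

lemma valid_weights_zeroed: "valid_weights d w \<Longrightarrow> valid_weights d (zeroed_weights Xh w)"
  by (auto simp: valid_weights_def)

lemma sum_zeroed_weights:
  "finite X \<Longrightarrow> sum (zeroed_weights Xh w) X = sum w (X - Xh)"
  by (simp add: sum.If_cases Diff_eq)

lemma optimal_solution_exists:
  assumes "finite (feasible P d)" "feasible P d \<noteq> {}"
  shows "\<exists>X. optimal_solution P d w X"
  unfolding optimal_solution_def
  using ex_is_arg_min_if_finite[OF assms, of "sum w"]
  by (auto simp: is_arg_min_linorder)

text \<open>\<open>approximation_algorithm\<close> compares only with optimal solutions. There are
  finitely many feasible sets, so an optimum exists, and since \<rho> is non-negative the bound
  passes to every feasible set.\<close>

lemma approximation_algorithm_output:
  assumes "wf_selection_problem P" "0 \<le> \<rho>" "approximation_algorithm P \<rho> A"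
    and "d \<in> families P" "valid_weights d w"
  shows "\<exists>X\<in>feasible P d. outputs_set A (plain_input d w) X \<and>
    (\<forall>X'\<in>feasible P d. sum w X \<le> \<rho> * sum w X')"
proof -
  obtain X where X: "X \<in> feasible P d" "outputs_set A (plain_input d w) X"
    and opt: "\<And>Y. optimal_solution P d w Y \<Longrightarrow> sum w X \<le> \<rho> * sum w Y"
    using assms unfolding approximation_algorithm_def by blast
  have "finite (feasible P d)"
    using assms finite_subset[of _ "Pow (items d)"] by (auto simp: wf_selection_problem_def)
  then obtain Y where Y: "optimal_solution P d w Y"
    using optimal_solution_exists X(1) by blast
  have "sum w X \<le> \<rho> * sum w X'" if "X' \<in> feasible P d" for X'
  proof -
    have "sum w Y \<le> sum w X'" using Y that by (simp add: optimal_solution_def)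
    then show ?thesis using opt[OF Y] assms(2) mult_left_mono order_trans by blast
  qed
  then show ?thesis using X by blast
qed

text \<open>Splitting \<open>X\<close>, \<open>X'\<close> and \<open>Xh\<close> along one another
  leaves a linear inequality. Its only lossy steps are the approximation bound and
  \<open>sum w (X \<inter> Xh) \<le> sum w Xh\<close>, which rests on non-negative weights in
  \<open>Xh\<close>.\<close>

lemma sum_le_of_zeroed_weights_approx:
  fixes w :: "nat \<Rightarrow> real"
  assumes "finite X" "finite X'" "finite Xh" and nonneg: "\<And>i. i \<in> Xh \<Longrightarrow> 0 \<le> w i"
    and approx: "sum (zeroed_weights Xh w) X \<le> \<rho> * sum (zeroed_weights Xh w) X'"
  shows "sum w X \<le> sum w X' + sum w (Xh - X') + (\<rho> - 1) * sum w (X' - Xh)"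
proof -
  have "sum w X = sum w (X \<inter> Xh) + sum w (X - Xh)"
    using assms(1) by (rule sum.Int_Diff)
  moreover have "sum w (X \<inter> Xh) \<le> sum w Xh"
    using assms(3) nonneg by (intro sum_mono2) auto
  moreover have "sum w (X - Xh) \<le> \<rho> * sum w (X' - Xh)"
    using approx assms(1,2) by (simp only: sum_zeroed_weights)
  moreover have "sum w Xh = sum w (X' \<inter> Xh) + sum w (Xh - X')"
    using sum.Int_Diff[OF assms(3), of w X'] by (simp add: Int_commute)
  moreover have "sum w X' = sum w (X' \<inter> Xh) + sum w (X' - Xh)"
    using assms(2) by (rule sum.Int_Diff)
  ultimately show ?thesis by (simp add: algebra_simps)
qed

section \<open>Reading the zeroed input from the augmented one\<close>

lemma lookup_Cons: "lookup (x # xs) k = (if k = 0 then x else lookup xs (k - 1))"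
  by (auto simp: lookup_def nth_Cons' nat_diff_distrib)

lemma lookup_append:
  "lookup (xs @ ys) k = (if k < int (length xs) then lookup xs k else lookup ys (k - int (length xs)))"
  by (auto simp: lookup_def nth_append nat_diff_distrib nat_less_iff)

lemma lookup_map_upt:
  "lookup (map f [Suc 0..<Suc n]) k = (if 0 \<le> k \<and> k < int n then f (Suc (nat k)) else 0)"
  by (auto simp: lookup_def nat_less_iff simp del: upt_Suc)

lemma lookup_augmented_num_items:
  "lookup (fst (augmented_input d w Xh)) 0 = int (num_items d)"
  by (simp add: augmented_input_def lookup_Cons)

text \<open>The prediction vector sits between cell 0 and the data, so positive addresses shift by
  \<open>num_items d\<close>; cell 0 agrees, and negative addresses read as 0 in both arrays. The
  weights \<open>w'\<close> are arbitrary because they do not enter the integer array.\<close>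

lemma lookup_plain_int:
  "lookup (fst (plain_input d w')) k =
    lookup (fst (augmented_input d w Xh)) (if 0 < k then int (num_items d) + k else k)"
  by (auto simp: augmented_input_def plain_input_def lookup_Cons lookup_append lookup_map_upt
      simp del: upt_Suc) (auto simp: lookup_def)

lemma length_plain_int:
  "int (length (fst (plain_input d w'))) =
    int (length (fst (augmented_input d w Xh))) - int (num_items d)"
  by (simp add: augmented_input_def plain_input_def del: upt_Suc)

lemma length_plain_real:
  "length (snd (plain_input d w')) = length (snd (augmented_input d w Xh))"
  by (simp add: augmented_input_def plain_input_def del: upt_Suc)

text \<open>
  For \<open>k < 0\<close> the test may inspect a cell unrelated to the prediction (for \<open>k = -1\<close> the number of
  items), which is harmless since the real array reads as 0 there anyway.
\<close>

lemma lookup_plain_zeroed_real: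
  "lookup (snd (plain_input d (zeroed_weights Xh w))) k =
    (if k < int (num_items d) \<and> 0 < lookup (fst (augmented_input d w Xh)) (1 + k)
     then 0 else lookup (snd (augmented_input d w Xh)) k)"
  by (cases "0 \<le> k")
    (auto simp: augmented_input_def plain_input_def lookup_Cons lookup_append lookup_map_upt
      simp del: upt_Suc)

section \<open>The modified machine\<close>

text \<open>
  Integer registers 0 and 1 serve as scratch space; register \<open>x\<close> of the given machine is kept in
  register \<open>x + 2\<close>. The parameter \<open>i\<close> is the address of the translated instruction.
\<close>

fun translation :: "nat \<Rightarrow> instr \<Rightarrow> instr list" where
  "translation i (IConst x k) = [IConst (x + 2) k]"
| "translation i (IArith f x y z) = [IArith f (x + 2) (y + 2) (z + 2)]"
| "translation i (ILoad x y) = [ILoad (x + 2) (y + 2)]"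
| "translation i (IStore x y) = [IStore (x + 2) (y + 2)]"
| "translation i (IRead x y) =
    [IConst 0 0, IJumpLess 0 (y + 2) (12 * i + 4), IRead (x + 2) (y + 2), Jump (12 * Suc i),
     IRead 0 0, IArith Add 0 0 (y + 2), IRead (x + 2) 0]"
| "translation i (ILen x) = [IConst 0 0, IRead 0 0, ILen (x + 2), IArith Sub (x + 2) (x + 2) 0]"
| "translation i (RofI x y) = [RofI x (y + 2)]"
| "translation i (RArith f x y z) = [RArith f x y z]"
| "translation i (RLoad x y) = [RLoad x (y + 2)]"
| "translation i (RStore x y) = [RStore (x + 2) y]"
| "translation i (RRead x y) =
    [RRead x (y + 2), IConst 0 0, IRead 1 0, IJumpLess (y + 2) 1 (12 * i + 5), Jump (12 * Suc i),
     IConst 1 1, IArith Add 1 1 (y + 2), IRead 1 1, IJumpLess 0 1 (12 * i + 10), Jump (12 * Suc i),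
     RofI x 0]"
| "translation i (RLen x) = [RLen (x + 2)]"
| "translation i (Emit x) = [Emit (x + 2)]"
| "translation i (Jump l) = [Jump (12 * l)]"
| "translation i (IJumpLess x y l) = [IJumpLess (x + 2) (y + 2) (12 * l)]"
| "translation i (RJumpLess x y l) = [RJumpLess x y (12 * l)]"

text \<open>A fixed block length turns a jump target \<open>l\<close> into \<open>12 * l\<close>.
  The longest translation, that of \<open>RRead\<close>, has 11 instructions, so every block ends
  with at least one padding jump to the next block.\<close>

definition block :: "nat \<Rightarrow> instr \<Rightarrow> nat \<Rightarrow> instr" where
  "block i a j = (if j < length (translation i a) then translation i a ! j else Jump (12 * Suc i))"

definition zeroing_program :: "ram_program \<Rightarrow> ram_program" where
  "zeroing_program A = map (\<lambda>k. block (k div 12) (A ! (k div 12)) (k mod 12)) [0..<12 * length A]"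

section \<open>Step-by-step simulation of the given machine\<close>

text \<open>Configurations are compared only at block boundaries. Registers 0 and 1 of
  \<open>c'\<close> are unconstrained, so scratch values need not survive a block.\<close>

definition simulates :: "config \<Rightarrow> config \<Rightarrow> bool" where
  "simulates c' c \<longleftrightarrow> pc c' = 12 * pc c \<and> (\<forall>x. ireg c' (x + 2) = ireg c x) \<and> rreg c' = rreg c \<and>
     imem c' = imem c \<and> rmem c' = rmem c \<and> out c' = out c"

lemma simulates_init: "simulates init_config init_config"
  by (simp add: simulates_def init_config_def)

lemma simulates_halted: "simulates c' c \<Longrightarrow> halted (zeroing_program A) c' \<longleftrightarrow> halted A c"
  by (simp add: simulates_def halted_def zeroing_program_def)

text \<open>A rule for symbolic execution: it peels off one step, with the address given as block
  \<open>i\<close> and offset \<open>j\<close>, so that \<open>div\<close> and \<open>mod\<close>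
  are resolved once here. The number \<open>n\<close> is the remaining step budget.\<close>

lemma zeroing_program_run:
  assumes "i < length A" "pc c = 12 * i + j" "j < 12" "0 < n"
    and "\<exists>k\<le>n - 1. Q ((step (zeroing_program A) I ^^ k) (exec I (block i (A ! i) j) c))"
  shows "\<exists>k\<le>n. Q ((step (zeroing_program A) I ^^ k) c)"
proof -
  have "pc c < 12 * length A" "pc c div 12 = i" "pc c mod 12 = j"
    using assms(1-3) by auto
  then have "step (zeroing_program A) I c = exec I (block i (A ! i) j) c"
    by (simp add: step_def halted_def zeroing_program_def)
  moreover obtain k where "k \<le> n - 1"
    "Q ((step (zeroing_program A) I ^^ k) (exec I (block i (A ! i) j) c))"
    using assms(5) by blast
  ultimately show ?thesis
    using assms(4) by (intro exI[of _ "Suc k"]) (auto simp: funpow_swap1)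
qed

text \<open>Each block is executed symbolically. Jumps inside a block only go forward, so it is left
  after at most 12 steps.\<close>

lemma simulates_exec:
  assumes sim: "simulates c' c" and pc: "pc c < length A"
  shows "\<exists>k\<le>12. simulates ((step (zeroing_program A) (augmented_input d w Xh) ^^ k) c')
    (exec (plain_input d (zeroed_weights Xh w)) (A ! pc c) c)"
    (is "\<exists>k\<le>_. simulates ((step _ ?I ^^ k) c') ?c")
proof -
  have pc': "pc c' = 12 * pc c" and ireg: "\<And>x. ireg c' (Suc (Suc x)) = ireg c x"
    and eqs: "rreg c' = rreg c" "imem c' = imem c" "rmem c' = rmem c" "out c' = out c"
    using sim by (simp_all add: simulates_def)
  \<comment> \<open>Naming the target configuration keeps it folded while \<open>simp_all\<close>
    executes the block.\<close>
  define c1 where "c1 = ?c"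
  note run = zeroing_program_run[OF pc, where Q = "\<lambda>c'. simulates c' c1" and I = ?I]
  note stop = exI[of _ 0]
  note [simp] = pc' ireg eqs block_def lookup_augmented_num_items
  have "\<exists>k\<le>12. simulates ((step (zeroing_program A) ?I ^^ k) c') c1"
  proof (cases "A ! pc c")
    case [simp]: (IRead x y)
    show ?thesis
    \<comment> \<open>Positive addresses must skip the prediction vector, whose length is fetched
      from cell 0 into register 0.\<close>
    proof (cases "0 < ireg c y")
      case [simp]: True
      show ?thesis
        by (rule run[where j = 0], simp_all,
            rule run[where j = 1], simp_all,
            rule run[where j = 4], simp_all,
            rule run[where j = 5], simp_all,
            rule run[where j = 6], simp_all,
            rule run[where j = 7], simp_all,
            rule stop, simp add: simulates_def c1_def lookup_plain_int[of d _ _ w Xh])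
    next
      case [simp]: False
      show ?thesis
        by (rule run[where j = 0], simp_all,
            rule run[where j = 1], simp_all,
            rule run[where j = 2], simp_all,
            rule run[where j = 3], simp_all,
            rule stop, simp add: simulates_def c1_def lookup_plain_int[of d _ _ w Xh])
    qed
  next
    case [simp]: (ILen x)
    show ?thesis
      by (rule run[where j = 0], simp_all,
          rule run[where j = 1], simp_all,
          rule run[where j = 2], simp_all,
          rule run[where j = 3], simp_all,
          rule run[where j = 4], simp_all,
          rule stop, simp add: simulates_def c1_def length_plain_int[of d _ w Xh])
  next
    case [simp]: (RRead x y)
    show ?thesis
    \<comment> \<open>From address \<open>num_items d\<close> on there are no weights, so the value
      is read unchanged.\<close>
    proof (cases "ireg c y < int (num_items d)")
      case [simp]: True
      show ?thesis
      \<comment> \<open>The weight at real address \<open>k\<close> belongs to item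
        \<open>k + 1\<close>, whose prediction bit has integer address \<open>1 + k\<close> because
        cell 0 holds the number of items. If the test succeeds, \<open>RofI\<close> overwrites the
        value with the 0 kept in register 0.\<close>
      proof (cases "0 < lookup (fst ?I) (1 + ireg c y)")
        case [simp]: True
        show ?thesis
          by (rule run[where j = 0], simp_all,
              rule run[where j = 1], simp_all,
              rule run[where j = 2], simp_all,
              rule run[where j = 3], simp_all,
              rule run[where j = 5], simp_all,
              rule run[where j = 6], simp_all,
              rule run[where j = 7], simp_all,
              rule run[where j = 8], simp_all,
              rule run[where j = 10], simp_all,
              rule run[where j = 11], simp_all,
              rule stop, simp add: simulates_def c1_def lookup_plain_zeroed_real)
      next
        case [simp]: False
        show ?thesis
          by (rule run[where j = 0], simp_all,
              rule run[where j = 1], simp_all,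
              rule run[where j = 2], simp_all,
              rule run[where j = 3], simp_all,
              rule run[where j = 5], simp_all,
              rule run[where j = 6], simp_all,
              rule run[where j = 7], simp_all,
              rule run[where j = 8], simp_all,
              rule run[where j = 9], simp_all,
              rule stop, simp add: simulates_def c1_def lookup_plain_zeroed_real)
      qed
    next
      case [simp]: False
      show ?thesis
        by (rule run[where j = 0], simp_all,
            rule run[where j = 1], simp_all,
            rule run[where j = 2], simp_all,
            rule run[where j = 3], simp_all,
            rule run[where j = 4], simp_all,
            rule stop, simp add: simulates_def c1_def lookup_plain_zeroed_real)
    qed
  next
    case [simp]: (Jump l)
    show ?thesis
      by (rule run[where j = 0], simp_all, rule stop, simp add: simulates_def c1_def)
  next
    case [simp]: (IJumpLess x y l)
    show ?thesis
    proof (cases "ireg c x < ireg c y")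
      case [simp]: True
      show ?thesis
        by (rule run[where j = 0], simp_all, rule stop, simp add: simulates_def c1_def)
    next
      case [simp]: False
      show ?thesis
        by (rule run[where j = 0], simp_all, rule run[where j = 1], simp_all,
            rule stop, simp add: simulates_def c1_def)
    qed
  next
    case [simp]: (RJumpLess x y l)
    show ?thesis
    proof (cases "rreg c x < rreg c y")
      case [simp]: True
      show ?thesis
        by (rule run[where j = 0], simp_all, rule stop, simp add: simulates_def c1_def)
    next
      case [simp]: False
      show ?thesis
        by (rule run[where j = 0], simp_all, rule run[where j = 1], simp_all,
            rule stop, simp add: simulates_def c1_def)
    qed
  \<comment> \<open>Each remaining instruction becomes one instruction followed by a padding
    jump.\<close>
  qed ((rule run[where j = 0], simp_all, rule run[where j = 1], simp_all,
      rule stop, simp add: simulates_def c1_def length_plain_real[of d _ w Xh])[1])+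
  then show ?thesis by (simp only: c1_def)
qed

text \<open>Induction on \<open>t\<close>: every step of the given machine costs at most one pass
  through a block, which yields the constant factor 12.\<close>

lemma simulates_config_after:
  "\<exists>t'\<le>12 * t. simulates (config_after (zeroing_program A) (augmented_input d w Xh) t')
    (config_after A (plain_input d (zeroed_weights Xh w)) t)"
proof (induction t)
  case 0
  show ?case by (simp add: config_after_def simulates_init)
next
  case (Suc t)
  let ?B = "zeroing_program A" and ?I = "augmented_input d w Xh"
    and ?c = "config_after A (plain_input d (zeroed_weights Xh w)) t"
  obtain t' where t': "t' \<le> 12 * t" "simulates (config_after ?B ?I t') ?c"
    using Suc.IH by blast
  have c: "config_after A (plain_input d (zeroed_weights Xh w)) (Suc t) =
      step A (plain_input d (zeroed_weights Xh w)) ?c"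
    by (simp add: config_after_def)
  show ?case
  proof (cases "halted A ?c")
    case True
    \<comment> \<open>A halted configuration repeats itself, so the old \<open>t'\<close> still
      serves.\<close>
    then show ?thesis using t' by (intro exI[of _ t']) (simp add: c step_def)
  next
    case False
    then obtain k where "k \<le> 12" "simulates ((step ?B ?I ^^ k) (config_after ?B ?I t'))
        (step A (plain_input d (zeroed_weights Xh w)) ?c)"
      using simulates_exec[OF t'(2), of A d w Xh] by (auto simp: halted_def step_def)
    then show ?thesis
      using t'(1) by (intro exI[of _ "k + t'"]) (simp add: c config_after_def funpow_add)
  qed
qed

section \<open>Running time and output of the modified machine\<close>

lemma halts_within_zeroing_program:
  assumes "halts_within A (plain_input d (zeroed_weights Xh w)) b"
  shows "halts_within (zeroing_program A) (augmented_input d w Xh) (12 * b)"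
proof -
  obtain t where t: "real t \<le> b"
      "halted A (config_after A (plain_input d (zeroed_weights Xh w)) t)"
    using assms by (auto simp: halts_within_def)
  obtain t' where "t' \<le> 12 * t"
      "simulates (config_after (zeroing_program A) (augmented_input d w Xh) t')
        (config_after A (plain_input d (zeroed_weights Xh w)) t)"
    using simulates_config_after by blast
  then show ?thesis
    unfolding halts_within_def using t simulates_halted by (intro exI[of _ t']) auto
qed

lemma outputs_set_zeroing_program:
  assumes "outputs_set A (plain_input d (zeroed_weights Xh w)) X"
  shows "outputs_set (zeroing_program A) (augmented_input d w Xh) X"
proof -
  obtain t where t: "halted A (config_after A (plain_input d (zeroed_weights Xh w)) t)"
      "set (out (config_after A (plain_input d (zeroed_weights Xh w)) t)) = int ` X"
    using assms by (auto simp: outputs_set_def)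
  obtain t' where "simulates (config_after (zeroing_program A) (augmented_input d w Xh) t')
        (config_after A (plain_input d (zeroed_weights Xh w)) t)"
    using simulates_config_after by blast
  then show ?thesis
    unfolding outputs_set_def using t simulates_halted[of _ _ A]
    by (intro exI[of _ t'] conjI) (blast, simp add: simulates_def)
qed

theorem theorem1:
  fixes P :: selection_problem and A :: ram_program and \<rho> :: real and T :: "nat \<Rightarrow> real"
  assumes "wf_selection_problem P"
    and "1 \<le> \<rho>"
    and "approximation_algorithm P \<rho> A"
    and "runs_in_time P A T"
  shows "\<exists>B T'. T' \<in> O(T) \<and> augmented_runs_in_time P B T' \<and>
    (\<forall>d\<in>families P. \<forall>w Xh. valid_weights d w \<longrightarrow> Xh \<subseteq> items d \<longrightarrow>
      (\<exists>X\<in>feasible P d. outputs_set B (augmented_input d w Xh) X \<and>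
        (\<forall>X'\<in>feasible P d.
          (let (\<eta>p, \<eta>m) = prediction_error w Xh X'
           in sum w X \<le> sum w X' + \<eta>p + (\<rho> - 1) * \<eta>m))))"
proof (intro exI conjI ballI allI impI)
  show "(\<lambda>n. 12 * T n) \<in> O(T)" by simp
  \<comment> \<open>The bound \<open>T\<close> depends only on the number of items, so it applies
    equally to the run on the zeroed weights.\<close>
  show "augmented_runs_in_time P (zeroing_program A) (\<lambda>n. 12 * T n)"
    using assms(4) valid_weights_zeroed halts_within_zeroing_program
    by (auto simp: augmented_runs_in_time_def runs_in_time_def)
next
  fix d w Xh
  assume d: "d \<in> families P" and w: "valid_weights d w" and Xh: "Xh \<subseteq> items d"
  \<comment> \<open>Zeroing weights leaves \<open>d\<close> and hence \<open>feasible P d\<close>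
    unchanged, so \<open>X\<close> is feasible for the original instance as well.\<close>
  obtain X where X: "X \<in> feasible P d" "outputs_set A (plain_input d (zeroed_weights Xh w)) X"
    and approx: "\<And>X'. X' \<in> feasible P d \<Longrightarrow>
      sum (zeroed_weights Xh w) X \<le> \<rho> * sum (zeroed_weights Xh w) X'"
    using approximation_algorithm_output[OF assms(1) _ assms(3) d valid_weights_zeroed[OF w, of Xh]]
      assms(2) by fastforce
  have finite_feasible: "finite Y" if "Y \<in> feasible P d" for Y
    using assms(1) d that finite_subset[of Y "items d"] by (auto simp: wf_selection_problem_def)
  have nonneg: "0 \<le> w i" if "i \<in> Xh" for i
    using w Xh that by (auto simp: valid_weights_def)
  have "sum w X \<le> sum w X' + sum w (Xh - X') + (\<rho> - 1) * sum w (X' - Xh)"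
    if "X' \<in> feasible P d" for X'
    using finite_feasible[OF X(1)] finite_feasible[OF that] finite_subset[OF Xh] nonneg approx[OF that]
    by (intro sum_le_of_zeroed_weights_approx) simp_all
  then show "\<exists>X\<in>feasible P d. outputs_set (zeroing_program A) (augmented_input d w Xh) X \<and>
      (\<forall>X'\<in>feasible P d. let (\<eta>p, \<eta>m) = prediction_error w Xh X'
         in sum w X \<le> sum w X' + \<eta>p + (\<rho> - 1) * \<eta>m)"
    using X outputs_set_zeroing_program
    by (intro bexI[of _ X]) (auto simp: prediction_error_def)
qed

end
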